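(* Consider the joint base-station activation and coordinated beamforming problem (P) described in the context. For any $\epsilon\ge 0$, the Benders' decomposition method (Algorithm 1, described in the context) produces an $\epsilon$-optimal solution of (P) in a finite number of iterations. Here an $\epsilon$-optimal solution is a feasible point $(\boldsymbol W^*,\boldsymbol a^* )$ of (P) whose objective value is at most the optimal value of (P) plus $\epsilon$; the case $\epsilon=0$ (exact optimality) is included.
   Context: **Data.** Integers $L,K\ge 1$ (numbers of base stations and users) and $N_l\ge 1$ (number of antennas of base station $l$), $l=1,\dots,L$. Channel vectors $\boldsymbol h_{lk}\in\mathbb C^{N_l}$. Reals $\sigma_k^2>0$ (noise variances), $\gamma_k>0$ (SINR targets), $P_l>0$ (power limits), $\pi_l>0$ (implementation powers). Put $\boldsymbol\pi=[\pi_1,\dots,\pi_L]^T$ and $N=\sum_l N_l$. Let $\boldsymbol h_k=[\boldsymbol h_{1k}^T,\dots,\boldsymbol h_{Lk}^T]^T\in\mathbb C^N$. For beamforming vectors $\boldsymbol w_{lk}\in\mathbb C^{N_l}$ (from base station $l$ to user $k$) let $\boldsymbol w_k=[\boldsymbol w_{1k}^T,\dots,\boldsymbol w_{Lk}^T]^T\in\mathbb C^N$ and $\boldsymbol W=\{\boldsymbol w_k\}_{k=1}^K$. Let $\boldsymbol B_l$ be the $N\times N$ diagonal $0/1$ matrix selecting the block of coordinates of base station $l$, so that $\boldsymbol w_k^H\boldsymbol B_l\boldsymbol w_k=\|\boldsymbol w_{lk}\|^2$. **Problem (P).** Minimize $\sum_{l=1}^L\sum_{k=1}^K\|\boldsymbol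 w_{lk}\|^2+\boldsymbol a^T\boldsymbol\pi$ over $(\boldsymbol W,\boldsymbol a)$, $\boldsymbol a=[a_1,\dots,a_L]^T$, subject to - $\dfrac{|\sum_{l}\boldsymbol h_{lk}^H\boldsymbol w_{lk}|^2}{\sum_{i\ne k}|\sum_{l}\boldsymbol h_{lk}^H\boldsymbol w_{li}|^2+\sigma_k^2}\ge\gamma_k$ for all $k$; - $\sum_{k}\|\boldsymbol w_{lk}\|^2\le a_lP_l$ for all $l$; - $a_l\in\{0,1\}$ for all $l$. (P) is taken to be feasible. **Notation.** $\mathcal A=\{0,1\}^L$. $\mathcal W$ is the set of all $\boldsymbol W$ such that, for all $k$, $\sqrt{\sum_{i\ne k}|\boldsymbol h_k^H\boldsymbol w_i|^2+\sigma_k^2}\le\frac1{\sqrt{\gamma_k}}\mathrm{Re}(\boldsymbol h_k^H\boldsymbol w_k)$ and $\mathrm{Im}(\boldsymbol h_k^H\boldsymbol w_k)=0$. (A phase rotation of each $\boldsymbol w_k$ changes neither the objective nor the constraints of (P), so the SINR constraints may be replaced by $\boldsymbol W\in\mathcal W$.) Let $$f(\boldsymbol W,\boldsymbol a)=\sum_k\boldsymbol w_k^H\boldsymbol w_k+\boldsymbol a^T\boldsymbol\pi,\qquad \boldsymbol G(\boldsymbol W,\boldsymbol a)=\Bigl(\sum_k\boldsymbol w_k^H\boldsymbol B_l\boldsymbol w_k-a_lP_l\Bigr)_{l=1}^L .$$ For a given $\boldsymbol a$, the subproblem $[\mathrm{S}\text{-}\boldsymbol a]$ is the convex problem $$v(\boldsymbol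 a)=\min\{f(\boldsymbol W,\boldsymbol a):\boldsymbol W\in\mathcal W,\ \boldsymbol G(\boldsymbol W,\boldsymbol a)\le\boldsymbol 0\},$$ and $\mathcal V$ is the set of $\boldsymbol a$ for which it is feasible. Let $\Lambda=\{\boldsymbol\lambda\in\mathbb R^L:\boldsymbol\lambda\ge\boldsymbol 0,\ \boldsymbol 1^T\boldsymbol\lambda=1\}$. For $\boldsymbol\mu\ge\boldsymbol 0$ and $\boldsymbol\lambda\in\Lambda$ define $$L^*(\boldsymbol a,\boldsymbol\mu)=\min_{\boldsymbol W\in\mathcal W}\{f(\boldsymbol W,\boldsymbol a)+\boldsymbol\mu^T\boldsymbol G(\boldsymbol W,\boldsymbol a)\}=\sum_l a_l(\pi_l-\mu_lP_l)+C_1(\boldsymbol\mu),$$ $$L_*(\boldsymbol a,\boldsymbol\lambda)=\min_{\boldsymbol W\in\mathcal W}\boldsymbol\lambda^T\boldsymbol G(\boldsymbol W,\boldsymbol a)=-\sum_l a_l\lambda_lP_l+C_2(\boldsymbol\lambda),$$ where $C_1(\boldsymbol\mu)=\min_{\boldsymbol W\in\mathcal W}\{\sum_k\boldsymbol w_k^H\boldsymbol w_k+\sum_l\mu_l\sum_k\boldsymbol w_k^H\boldsymbol B_l\boldsymbol w_k\}$ and $C_2(\boldsymbol\lambda)=\min_{\boldsymbol W\in\mathcal W}\sum_l\lambda_l\sum_k\boldsymbol w_k^H\boldsymbol B_l\boldsymbol w_k$. The optimal multiplier (optimal dual vector) for a feasible $[\mathrm{S}\text{-}\hat{\boldsymbol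 a}]$ is $\hat{\boldsymbol\mu}\in\arg\max_{\boldsymbol\mu\ge\boldsymbol 0}L^*(\hat{\boldsymbol a},\boldsymbol\mu)$. **Algorithm 1 (Benders' decomposition method).** Initialize: given an accuracy level $\epsilon\ge0$ and a vector $\hat{\boldsymbol a}\in\mathcal A$, set $p=q=0$, $\mathrm{LB}=-\infty$, $\mathrm{UB}=\infty$. Repeat: 1) Solve $[\mathrm{S}\text{-}\hat{\boldsymbol a}]$ and act according to one of two cases. - (a) $[\mathrm{S}\text{-}\hat{\boldsymbol a}]$ is infeasible ($\hat{\boldsymbol a}\notin\mathcal V$): obtain a $\hat{\boldsymbol\lambda}\in\Lambda$ satisfying $\min_{\boldsymbol W\in\mathcal W}\hat{\boldsymbol\lambda}^T\boldsymbol G(\boldsymbol W,\hat{\boldsymbol a})>0$ and compute the function $L_*(\boldsymbol a,\hat{\boldsymbol\lambda})$. Let $q=q+1$ and $\boldsymbol\lambda_q=\hat{\boldsymbol\lambda}$; go to 2). - (b) $[\mathrm{S}\text{-}\hat{\boldsymbol a}]$ is feasible ($\hat{\boldsymbol a}\in\mathcal V$): let $v(\hat{\boldsymbol a})$ and $\boldsymbol W(\hat{\boldsymbol a})$ be its optimal value and optimal solution. (i) If $v(\hat{\boldsymbol a})\le\mathrm{LB}+\epsilon$, terminate; output $\boldsymbol W^*=\boldsymbol W(\hat{\boldsymbol a})$ and $\boldsymbol a^*=\hat{\boldsymbol a}$. (ii) Otherwise, determine the optimal multiplier $\hat{\boldsymbol\mu}$ and the function $L^*(\boldsymbol a,\hat{\boldsymbol\mu})$.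 If $v(\hat{\boldsymbol a})<\mathrm{UB}$, update $\mathrm{UB}=v(\hat{\boldsymbol a})$, $\boldsymbol W^*=\boldsymbol W(\hat{\boldsymbol a})$, $\boldsymbol a^*=\hat{\boldsymbol a}$. Let $p=p+1$ and $\boldsymbol\mu_p=\hat{\boldsymbol\mu}$; go to 2). 2) Solve the relaxed master problem: minimize $a_0$ over $\boldsymbol a\in\mathcal A$ and $a_0\in\mathbb R$ subject to $a_0\ge L^*(\boldsymbol a,\boldsymbol\mu_j)$, $j=1,\dots,p$, and $L_*(\boldsymbol a,\boldsymbol\lambda_j)\le0$, $j=1,\dots,q$. Let $(\hat{\boldsymbol a},\hat a_0)$ be an optimal solution. If $\mathrm{UB}\le\hat a_0+\epsilon$, terminate; output $(\boldsymbol W^*,\boldsymbol a^* )$. Otherwise, let $\mathrm{LB}=\hat a_0$ and return to 1).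
   Formalization: Progress to the next step is claimed only where the optimal multiplier required in step 1(b)(ii) exists (the dual maximum may be unattained when some a_l = 0); with no optimality cuts (p = 0) the relaxed master problem takes the value −∞ at any activation satisfying the feasibility cuts. *)

theory Defs
  imports "HOL-Analysis.Analysis"
begin

(* The L base stations, K users and N = N_1 + ... + N_L antennas are indexed by the finite types
   'l, 'k and 'n; antenna i belongs to base station "site D i", so N_l = card {i. site D i = l},
   and N_l >= 1 for all l says that site is surjective.  A stacked vector in C^N is a
   complex^'n.  The field noise holds the variances sigma_k^2, not the sigma_k. *)
record ('n::finite, 'l::finite, 'k::finite) network =
  site :: "'n \<Rightarrow> 'l"
  chan :: "complex^'n^'k"
  noise :: "real^'k"
  target :: "real^'k"
  power_limit :: "real^'l"
  impl_power :: "real^'l"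

definition valid_network :: "('n::finite, 'l::finite, 'k::finite) network \<Rightarrow> bool" where
  "valid_network D \<longleftrightarrow> surj (site D) \<and> (\<forall>k. noise D $ k > 0) \<and> (\<forall>k. target D $ k > 0)
     \<and> (\<forall>l. power_limit D $ l > 0) \<and> (\<forall>l. impl_power D $ l > 0)"

definition herm :: "complex^'n::finite \<Rightarrow> complex^'n \<Rightarrow> complex" where
  "herm u v = (\<Sum>i\<in>UNIV. cnj (u $ i) * v $ i)"

(* The block of base station l in a stacked vector, as an element of C^{N_l} padded with zeros. *)
definition block :: "('n::finite, 'l::finite, 'k::finite) network \<Rightarrow> 'l \<Rightarrow> complex^'n \<Rightarrow> complex^'n" where
  "block D l v = (\<chi> i. if site D i = l then v $ i else 0)"

definition activations :: "(real^'l::finite) set" where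
  "activations = {a. \<forall>l. a $ l \<in> {0, 1}}"


section \<open>Problem (P)\<close>

definition P_objective ::
  "('n::finite, 'l::finite, 'k::finite) network \<Rightarrow> complex^'n^'k \<Rightarrow> real^'l \<Rightarrow> real" where
  "P_objective D W a = (\<Sum>l\<in>UNIV. \<Sum>k\<in>UNIV. (norm (block D l (W $ k)))\<^sup>2) + a \<bullet> impl_power D"

definition SINR ::
  "('n::finite, 'l::finite, 'k::finite) network \<Rightarrow> complex^'n^'k \<Rightarrow> 'k \<Rightarrow> real" where
  "SINR D W k =
     (cmod (\<Sum>l\<in>UNIV. herm (block D l (chan D $ k)) (block D l (W $ k))))\<^sup>2 /
     ((\<Sum>i\<in>UNIV - {k}. (cmod (\<Sum>l\<in>UNIV. herm (block D l (chan D $ k)) (block D l (W $ i))))\<^sup>2)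
        + noise D $ k)"

definition P_feasible ::
  "('n::finite, 'l::finite, 'k::finite) network \<Rightarrow> ((complex^'n^'k) \<times> (real^'l)) set" where
  "P_feasible D = {(W, a).
     (\<forall>k. SINR D W k \<ge> target D $ k) \<and>
     (\<forall>l. (\<Sum>k\<in>UNIV. (norm (block D l (W $ k)))\<^sup>2) \<le> a $ l * power_limit D $ l) \<and>
     (\<forall>l. a $ l \<in> {0, 1})}"

definition P_value :: "('n::finite, 'l::finite, 'k::finite) network \<Rightarrow> real" where
  "P_value D = (INF (W, a) \<in> P_feasible D. P_objective D W a)"

definition eps_optimal ::
  "('n::finite, 'l::finite, 'k::finite) network \<Rightarrow> real \<Rightarrow> complex^'n^'k \<Rightarrow> real^'l \<Rightarrow> bool" where
  "eps_optimal D \<epsilon> W a \<longleftrightarrow> (W, a) \<in> P_feasible D \<and> P_objective D W a \<le> P_value D + \<epsilon>"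


section \<open>Subproblems and dual functions\<close>

definition beamformers ::
  "('n::finite, 'l::finite, 'k::finite) network \<Rightarrow> (complex^'n^'k) set" where
  "beamformers D = {W. \<forall>k.
     sqrt ((\<Sum>i\<in>UNIV - {k}. (cmod (herm (chan D $ k) (W $ i)))\<^sup>2) + noise D $ k)
       \<le> 1 / sqrt (target D $ k) * Re (herm (chan D $ k) (W $ k)) \<and>
     Im (herm (chan D $ k) (W $ k)) = 0}"

definition B_sel :: "('n::finite, 'l::finite, 'k::finite) network \<Rightarrow> 'l \<Rightarrow> complex^'n^'n" where
  "B_sel D l = (\<chi> i j. if i = j \<and> site D i = l then 1 else 0)"

(* The quadratic forms below are real; Re only adjusts the type. *)
definition f_obj ::
  "('n::finite, 'l::finite, 'k::finite) network \<Rightarrow> complex^'n^'k \<Rightarrow> real^'l \<Rightarrow> real" where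
  "f_obj D W a = (\<Sum>k\<in>UNIV. Re (herm (W $ k) (W $ k))) + a \<bullet> impl_power D"

definition G_con ::
  "('n::finite, 'l::finite, 'k::finite) network \<Rightarrow> complex^'n^'k \<Rightarrow> real^'l \<Rightarrow> real^'l" where
  "G_con D W a = (\<chi> l. (\<Sum>k\<in>UNIV. Re (herm (W $ k) (B_sel D l *v W $ k))) - a $ l * power_limit D $ l)"

definition sub_feasible ::
  "('n::finite, 'l::finite, 'k::finite) network \<Rightarrow> real^'l \<Rightarrow> (complex^'n^'k) set" where
  "sub_feasible D a = {W \<in> beamformers D. G_con D W a \<le> 0}"

definition \<V> :: "('n::finite, 'l::finite, 'k::finite) network \<Rightarrow> (real^'l) set" where
  "\<V> D = {a. sub_feasible D a \<noteq> {}}"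

(* Minima are written as infima.  Over the nonempty sets at hand these are finite, as all the
   functions involved are bounded below; the minimum defining L_lower need not be attained when
   some component of lam vanishes. *)
definition v_sub :: "('n::finite, 'l::finite, 'k::finite) network \<Rightarrow> real^'l \<Rightarrow> real" where
  "v_sub D a = (INF W \<in> sub_feasible D a. f_obj D W a)"

definition sub_solution ::
  "('n::finite, 'l::finite, 'k::finite) network \<Rightarrow> real^'l \<Rightarrow> complex^'n^'k \<Rightarrow> bool" where
  "sub_solution D a W \<longleftrightarrow> W \<in> sub_feasible D a \<and> f_obj D W a = v_sub D a"

definition \<Lambda> :: "(real^'l::finite) set" where
  "\<Lambda> = {lam. 0 \<le> lam \<and> (\<Sum>l\<in>UNIV. lam $ l) = 1}"

definition L_upper ::
  "('n::finite, 'l::finite, 'k::finite) network \<Rightarrow> real^'l \<Rightarrow> real^'l \<Rightarrow> real" where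
  "L_upper D a \<mu> = (INF W \<in> beamformers D. f_obj D W a + \<mu> \<bullet> G_con D W a)"

definition L_lower ::
  "('n::finite, 'l::finite, 'k::finite) network \<Rightarrow> real^'l \<Rightarrow> real^'l \<Rightarrow> real" where
  "L_lower D a lam = (INF W \<in> beamformers D. lam \<bullet> G_con D W a)"

definition optimal_multiplier ::
  "('n::finite, 'l::finite, 'k::finite) network \<Rightarrow> real^'l \<Rightarrow> real^'l \<Rightarrow> bool" where
  "optimal_multiplier D a \<mu> \<longleftrightarrow>
     0 \<le> \<mu> \<and> (\<forall>\<mu>'. 0 \<le> \<mu>' \<longrightarrow> L_upper D a \<mu>' \<le> L_upper D a \<mu>)"


section \<open>Benders' decomposition\<close>

(* The lists hold \<mu>_1, ..., \<mu>_p and lam_1, ..., lam_q.  The variable a_0 ranges over the extended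
   reals: for p = 0 the master problem is unbounded below, and its solutions are then the pairs
   (a, -\<infinity>) with a satisfying the cuts in ls.  For p > 0 minimizers are real-valued. *)
definition master_feasible ::
  "('n::finite, 'l::finite, 'k::finite) network \<Rightarrow> (real^'l) list \<Rightarrow> (real^'l) list
     \<Rightarrow> ((real^'l) \<times> ereal) set" where
  "master_feasible D ms ls = {(a, a\<^sub>0). a \<in> activations \<and>
     (\<forall>\<mu>\<in>set ms. a\<^sub>0 \<ge> ereal (L_upper D a \<mu>)) \<and> (\<forall>lam\<in>set ls. L_lower D a lam \<le> 0)}"

definition master_solution ::
  "('n::finite, 'l::finite, 'k::finite) network \<Rightarrow> (real^'l) list \<Rightarrow> (real^'l) list
     \<Rightarrow> real^'l \<Rightarrow> ereal \<Rightarrow> bool" where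
  "master_solution D ms ls a a\<^sub>0 \<longleftrightarrow> (a, a\<^sub>0) \<in> master_feasible D ms ls \<and>
     (\<forall>(a', a\<^sub>0')\<in>master_feasible D ms ls. a\<^sub>0 \<le> a\<^sub>0')"

(* Solve a ms ls LB UB inc: about to perform step 1 at the point a.
   Master ms ls LB UB inc: about to perform step 2.
   Here inc is the incumbent pair (W, a), which is None before the first update of UB. *)
datatype ('n::finite, 'l::finite, 'k::finite) config =
    Solve "real^'l" "(real^'l) list" "(real^'l) list" ereal ereal
      "((complex^'n^'k) \<times> (real^'l)) option"
  | Master "(real^'l) list" "(real^'l) list" ereal ereal
      "((complex^'n^'k) \<times> (real^'l)) option"
  | Output "complex^'n^'k" "real^'l"

(* Every choice the algorithm leaves open (solutions, multipliers, separating lam) is made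
   nondeterministically. *)
inductive step ::
  "('n::finite, 'l::finite, 'k::finite) network \<Rightarrow> real \<Rightarrow>
     ('n, 'l, 'k) config \<Rightarrow> ('n, 'l, 'k) config \<Rightarrow> bool"
  for D :: "('n::finite, 'l::finite, 'k::finite) network" and \<epsilon> :: real
where
  infeasible:
    "\<lbrakk>a \<notin> \<V> D; lam \<in> \<Lambda>; (INF W \<in> beamformers D. lam \<bullet> G_con D W a) > 0\<rbrakk>
     \<Longrightarrow> step D \<epsilon> (Solve a ms ls LB UB inc) (Master ms (ls @ [lam]) LB UB inc)"
| feasible_stop:
    "\<lbrakk>a \<in> \<V> D; sub_solution D a W; ereal (v_sub D a) \<le> LB + ereal \<epsilon>\<rbrakk>
     \<Longrightarrow> step D \<epsilon> (Solve a ms ls LB UB inc) (Output W a)"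
| feasible_better:
    "\<lbrakk>a \<in> \<V> D; sub_solution D a W; \<not> ereal (v_sub D a) \<le> LB + ereal \<epsilon>;
      optimal_multiplier D a \<mu>; ereal (v_sub D a) < UB\<rbrakk>
     \<Longrightarrow> step D \<epsilon> (Solve a ms ls LB UB inc)
           (Master (ms @ [\<mu>]) ls LB (ereal (v_sub D a)) (Some (W, a)))"
| feasible_no_better:
    "\<lbrakk>a \<in> \<V> D; \<not> ereal (v_sub D a) \<le> LB + ereal \<epsilon>;
      optimal_multiplier D a \<mu>; \<not> ereal (v_sub D a) < UB\<rbrakk>
     \<Longrightarrow> step D \<epsilon> (Solve a ms ls LB UB inc) (Master (ms @ [\<mu>]) ls LB UB inc)"
| master_stop:
    "\<lbrakk>master_solution D ms ls a a\<^sub>0; UB \<le> a\<^sub>0 + ereal \<epsilon>\<rbrakk>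
     \<Longrightarrow> step D \<epsilon> (Master ms ls LB UB (Some (W, a'))) (Output W a')"
| master_continue:
    "\<lbrakk>master_solution D ms ls a a\<^sub>0; \<not> UB \<le> a\<^sub>0 + ereal \<epsilon>\<rbrakk>
     \<Longrightarrow> step D \<epsilon> (Master ms ls LB UB inc) (Solve a ms ls a\<^sub>0 UB inc)"

definition initial :: "real^'l::finite \<Rightarrow> ('n::finite, 'l, 'k::finite) config" where
  "initial a = Solve a [] [] (-\<infinity>) \<infinity> None"

abbreviation reachable ::
  "('n::finite, 'l::finite, 'k::finite) network \<Rightarrow> real \<Rightarrow> real^'l
     \<Rightarrow> ('n, 'l, 'k) config \<Rightarrow> bool" where
  "reachable D \<epsilon> a c \<equiv> (step D \<epsilon>)\<^sup>*\<^sup>* (initial a) c"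

(* If step 1(b)(ii) is the next one to perform, the argmax of the dual function is nonempty.
   This can fail: for a_l = 0 no point satisfies the l-th power constraint strictly, and the dual
   supremum may be approached only as \<mu>_l tends to infinity. *)
definition multiplier_available ::
  "('n::finite, 'l::finite, 'k::finite) network \<Rightarrow> real \<Rightarrow> ('n, 'l, 'k) config \<Rightarrow> bool" where
  "multiplier_available D \<epsilon> c \<longleftrightarrow> (\<forall>a ms ls LB UB inc.
     c = Solve a ms ls LB UB inc \<and> a \<in> \<V> D \<and> \<not> ereal (v_sub D a) \<le> LB + ereal \<epsilon>
     \<longrightarrow> (\<exists>\<mu>. optimal_multiplier D a \<mu>))"

end

(* The value function of a subproblem is lower semicontinuous, because the constraint map and the
   objective are convex, continuous and coercive.  Hence the set of all upper bounds of values of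
   that map is closed and convex, and strict separation from it yields both a separating lambda in
   the infeasible case and a zero duality gap in the feasible case, without a Slater condition.
   Each visit to step 1 at a therefore adds a cut that either is violated at a or forces
   a_0 >= UB there, so that the master problem cannot return a again without termination.  There
   are only 2^L activation vectors.  All cuts are valid for (P), so master values are lower bounds. *)
theory Submission
  imports Defs
begin

section \<open>Upward closures of vector-valued convex maps and their separation from points\<close>

text \<open>A convergent sequence of bounds is dominated by a single \<open>b\<close>, the upper
  corner of a box around its range. All witnesses then lie in one bounded sublevel set, and the
  limit of a subsequence of them witnesses the limit bound.\<close>

lemma closed_upward_image:
  fixes S :: "'a::{heine_borel, t2_space} set" and q :: "'a \<Rightarrow> 'b::ordered_euclidean_space"
  assumes "closed S" and cont: "continuous_on S q" and bdd: "\<And>y. bounded {x \<in> S. q x \<le> y}"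
  shows "closed {y. \<exists>x\<in>S. q x \<le> y}"
  unfolding closed_sequential_limits
proof (intro allI impI)
  fix y l assume y: "(\<forall>n. y n \<in> {y. \<exists>x\<in>S. q x \<le> y}) \<and> y \<longlonglongrightarrow> l"
  then have "\<forall>n. \<exists>x. x \<in> S \<and> q x \<le> y n"
    unfolding mem_Collect_eq Bex_def by (rule conjunct1)
  then obtain x where "\<forall>n. x n \<in> S \<and> q (x n) \<le> y n"
    by (rule choice[THEN exE])
  then have x: "x n \<in> S" "q (x n) \<le> y n" for n
    by simp_all
  have "bounded (range y)"
    by (rule convergent_imp_bounded[OF conjunct2[OF y]])
  then obtain b where "range y \<subseteq> cbox (- b) b"
    by (rule bounded_subset_cbox_symmetric)
  then have "y n \<in> cbox (- b) b" for n
    by (rule subsetD) simp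
  then have b: "y n \<le> b" for n
    by (simp add: eucl_le[where 'a='b] mem_box)
  have "bounded (range x)"
    by (rule bounded_subset[OF bdd[of b]]) (auto intro: x(1) order_trans[OF x(2) b])
  then obtain r x0 where r: "strict_mono (r :: nat \<Rightarrow> nat)" "(x \<circ> r) \<longlonglongrightarrow> x0"
    using bounded_imp_convergent_subsequence by blast
  have x0: "x0 \<in> S"
    by (rule closed_sequentially[OF \<open>closed S\<close> _ r(2)]) (simp add: x(1))
  have "(\<lambda>n. q (x (r n))) \<longlonglongrightarrow> q x0"
    by (rule continuous_on_tendsto_compose[OF cont _ x0])
       (use r(2) x(1) in \<open>simp_all add: comp_def\<close>)
  moreover have "(\<lambda>n. y (r n)) \<longlonglongrightarrow> l"
    using LIMSEQ_subseq_LIMSEQ[OF _ r(1), of y l] y by (simp add: comp_def)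
  ultimately have "q x0 \<le> l"
    unfolding eucl_le[where 'a='b]
    by (intro ballI LIMSEQ_le[OF tendsto_inner[OF _ tendsto_const] tendsto_inner[OF _ tendsto_const]])
       (use x(2) in \<open>auto simp: eucl_le[where 'a='b]\<close>)
  then show "l \<in> {y. \<exists>x\<in>S. q x \<le> y}"
    by (intro CollectI bexI[OF _ x0])
qed

lemma convex_upward_image:
  fixes S :: "'a::real_vector set" and q :: "'a \<Rightarrow> 'b::ordered_euclidean_space"
  assumes "convex S"
    and q: "\<And>x y u v. \<lbrakk>u \<ge> 0; v \<ge> 0; u + v = 1\<rbrakk> \<Longrightarrow> q (u *\<^sub>R x + v *\<^sub>R y) \<le> u *\<^sub>R q x + v *\<^sub>R q y"
  shows "convex {y. \<exists>x\<in>S. q x \<le> y}"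
proof (rule convexI, clarify)
  fix y z x w and u v :: real
  assume *: "0 \<le> u" "0 \<le> v" "u + v = 1" "x \<in> S" "w \<in> S" "q x \<le> y" "q w \<le> z"
  have "q (u *\<^sub>R x + v *\<^sub>R w) \<le> u *\<^sub>R q x + v *\<^sub>R q w"
    by (rule q[OF *(1-3)])
  also have "\<dots> \<le> u *\<^sub>R y + v *\<^sub>R z"
    by (rule add_mono[OF scaleR_left_mono[OF *(6,1)] scaleR_left_mono[OF *(7,2)]])
  finally show "\<exists>x\<in>S. q x \<le> u *\<^sub>R y + v *\<^sub>R z"
    using convexD[OF assms(1) *(4,5,1-3)] by (rule bexI)
qed

text \<open>A point outside a closed convex set is strictly separated from it. The normal is
  nonnegative because the set contains the whole orthant above each of its points.\<close>

lemma separate_upward_image: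
  fixes S :: "'a::euclidean_space set" and q :: "'a \<Rightarrow> 'b::ordered_euclidean_space"
  assumes "closed S" "convex S" "S \<noteq> {}" "continuous_on S q"
    and "\<And>x y u v. \<lbrakk>u \<ge> 0; v \<ge> 0; u + v = 1\<rbrakk> \<Longrightarrow> q (u *\<^sub>R x + v *\<^sub>R y) \<le> u *\<^sub>R q x + v *\<^sub>R q y"
    and "\<And>y. bounded {x \<in> S. q x \<le> y}"
    and z: "\<not> (\<exists>x\<in>S. q x \<le> z)"
  obtains \<nu> b where "0 \<le> \<nu>" "\<nu> \<bullet> z < b" "\<And>x. x \<in> S \<Longrightarrow> b < \<nu> \<bullet> q x"
proof -
  have "\<exists>\<nu> b. \<nu> \<bullet> z < b \<and> (\<forall>y\<in>{y. \<exists>x\<in>S. q x \<le> y}. b < \<nu> \<bullet> y)"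
  proof (rule separating_hyperplane_closed_point)
    show "convex {y. \<exists>x\<in>S. q x \<le> y}"
      by (rule convex_upward_image) (rule assms, rule assms(5))
    show "closed {y. \<exists>x\<in>S. q x \<le> y}"
      by (rule closed_upward_image[OF assms(1,4)]) (rule assms(6))
    show "z \<notin> {y. \<exists>x\<in>S. q x \<le> y}"
      unfolding mem_Collect_eq by (rule z)
  qed
  then obtain \<nu> b where sep: "\<nu> \<bullet> z < b" "\<forall>y\<in>{y. \<exists>x\<in>S. q x \<le> y}. b < \<nu> \<bullet> y"
    by (elim exE conjE)
  have \<nu>: "b < \<nu> \<bullet> y" if "x \<in> S" "q x \<le> y" for x y
    by (rule bspec[OF sep(2)]) (rule CollectI, rule bexI[OF _ that(1)], rule that(2))
  obtain x where x: "x \<in> S"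
    using \<open>S \<noteq> {}\<close> by blast
  have "0 \<le> \<nu> \<bullet> i" if i: "i \<in> Basis" for i
  proof (rule ccontr)
    assume neg: "\<not> 0 \<le> \<nu> \<bullet> i"
    \<comment> \<open>Along a direction with negative \<open>\<nu> \<bullet> i\<close> the
      functional decreases; \<open>t\<close> is the step length at which it equals \<open>b\<close>,
      which contradicts the strict bound on the set.\<close>
    define t where "t = (b - \<nu> \<bullet> q x) / (\<nu> \<bullet> i)"
    have "t \<ge> 0"
      unfolding t_def using \<nu>[OF x order_refl] neg by (intro divide_nonpos_neg) linarith+
    moreover have "0 \<le> i"
      unfolding eucl_le[where 'a='b] using i by (simp add: inner_Basis)
    ultimately have "q x \<le> q x + t *\<^sub>R i"
      by (simp add: scaleR_nonneg_nonneg)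
    then have "b < \<nu> \<bullet> (q x + t *\<^sub>R i)"
      by (rule \<nu>[OF x])
    also have "\<nu> \<bullet> (q x + t *\<^sub>R i) = b"
      using neg by (simp add: t_def inner_add_right)
    finally show False
      by simp
  qed
  then have "0 \<le> \<nu>"
    by (simp add: eucl_le[where 'a='b])
  then show thesis
    by (rule that) (use sep(1) \<nu> order_refl in auto)
qed

section \<open>Squared norms, Hermitian forms and antenna blocks\<close>

lemma power2_norm_convex_le:
  fixes x y :: "'a::real_normed_vector"
  assumes "u \<ge> 0" "v \<ge> 0" "u + v = 1"
  shows "(norm (u *\<^sub>R x + v *\<^sub>R y))\<^sup>2 \<le> u * (norm x)\<^sup>2 + v * (norm y)\<^sup>2"
proof -
  have "norm (u *\<^sub>R x + v *\<^sub>R y) \<le> u * norm x + v * norm y"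
    using norm_triangle_ineq[of "u *\<^sub>R x" "v *\<^sub>R y"] assms by simp
  then have "(norm (u *\<^sub>R x + v *\<^sub>R y))\<^sup>2 \<le> (u * norm x + v * norm y)\<^sup>2"
    by (rule power_mono) simp
  also have "\<dots> \<le> u * (norm x)\<^sup>2 + v * (norm y)\<^sup>2"
  proof -
    have "u = 1 - v"
      using assms(3) by simp
    then show ?thesis
      using convex_onD[OF convex_power2, of v "norm x" "norm y"] assms(1,2) by simp
  qed
  finally show ?thesis .
qed

lemma power2_norm_vec: "(norm x)\<^sup>2 = (\<Sum>i\<in>UNIV. (norm (x $ i))\<^sup>2)"
  by (simp add: norm_vec_def L2_set_def sum_nonneg)

lemma herm_self: "Re (herm v v) = (norm v)\<^sup>2"
  by (simp add: herm_def power2_norm_vec cmod_power2 flip: power2_eq_square)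

lemma herm_add_right: "herm h (u + v) = herm h u + herm h v"
  by (simp add: herm_def distrib_left sum.distrib)

lemma herm_scaleR_right: "herm h (c *\<^sub>R v) = c *\<^sub>R herm h v"
  by (simp add: herm_def scaleR_sum_right)

lemma herm_smult_right: "herm h (\<chi> i. z * v $ i) = z * herm h v"
  by (simp add: herm_def sum_distrib_left algebra_simps)

lemma continuous_on_herm [continuous_intros]:
  "continuous_on S g \<Longrightarrow> continuous_on S (\<lambda>x. herm h (g x))"
  unfolding herm_def by (intro continuous_intros)

lemma norm_block: "(norm (block D l v))\<^sup>2 = (\<Sum>i\<in>UNIV. if site D i = l then (cmod (v $ i))\<^sup>2 else 0)"
  unfolding power2_norm_vec by (intro sum.cong) (auto simp: block_def)

lemma sum_norm_block: "(\<Sum>l\<in>UNIV. (norm (block D l v))\<^sup>2) = (norm v)\<^sup>2"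
  unfolding norm_block by (subst sum.swap) (simp add: power2_norm_vec)

text \<open>Each antenna belongs to exactly one base station, so after exchanging the sums the inner
  one has a single surviving term.\<close>

lemma sum_herm_block: "(\<Sum>l\<in>UNIV. herm (block D l u) (block D l v)) = herm u v"
proof -
  have "(\<Sum>l\<in>UNIV. herm (block D l u) (block D l v)) =
      (\<Sum>l\<in>UNIV. \<Sum>i\<in>UNIV. if site D i = l then cnj (u $ i) * v $ i else 0)"
    unfolding herm_def block_def by (intro sum.cong refl) auto
  also have "\<dots> = herm u v"
    by (subst sum.swap) (simp add: herm_def)
  finally show ?thesis .
qed

lemma herm_B_sel: "Re (herm v (B_sel D l *v v)) = (norm (block D l v))\<^sup>2"
proof -
  have "(B_sel D l *v v) $ i = (if site D i = l then v $ i else 0)" for i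
  proof -
    have "B_sel D l $ i $ j * v $ j = (if i = j then (if site D i = l then v $ i else 0) else 0)" for j
      by (simp add: B_sel_def)
    then show ?thesis
      by (simp add: matrix_vector_mult_def)
  qed
  then show ?thesis
    unfolding norm_block herm_def Re_sum
    by (intro sum.cong) (auto simp: cmod_power2 simp flip: power2_eq_square)
qed

section \<open>Convexity, continuity and coercivity of the subproblem data\<close>

definition site_power ::
  "('n::finite, 'l::finite, 'k::finite) network \<Rightarrow> 'l \<Rightarrow> complex^'n^'k \<Rightarrow> real" where
  "site_power D l W = (\<Sum>k\<in>UNIV. (norm (block D l (W $ k)))\<^sup>2)"

lemma G_con_nth: "G_con D W a $ l = site_power D l W - a $ l * power_limit D $ l"
  by (simp add: G_con_def site_power_def herm_B_sel)

lemma sum_site_power: "(\<Sum>l\<in>UNIV. site_power D l W) = (norm W)\<^sup>2"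
  unfolding site_power_def
  by (subst sum.swap) (simp add: sum_norm_block power2_norm_vec[of W])

lemma site_power_nonneg: "0 \<le> site_power D l W"
  by (simp add: site_power_def sum_nonneg)

lemma f_obj_eq: "f_obj D W a = (norm W)\<^sup>2 + a \<bullet> impl_power D"
  by (simp add: f_obj_def herm_self power2_norm_vec[of W])

lemma P_objective_eq: "P_objective D W a = f_obj D W a"
  by (simp add: P_objective_def f_obj_eq sum_site_power flip: site_power_def)

lemma site_power_convex:
  assumes "u \<ge> 0" "v \<ge> 0" "u + v = 1"
  shows "site_power D l (u *\<^sub>R V + v *\<^sub>R W) \<le> u * site_power D l V + v * site_power D l W"
proof -
  have "block D l ((u *\<^sub>R V + v *\<^sub>R W) $ k) = u *\<^sub>R block D l (V $ k) + v *\<^sub>R block D l (W $ k)" for k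
    by (simp add: block_def vec_eq_iff)
  then show ?thesis
    unfolding site_power_def sum_distrib_left sum.distrib[symmetric]
    by (auto intro!: sum_mono power2_norm_convex_le assms)
qed

lemma continuous_on_site_power: "continuous_on S (site_power D l)"
  unfolding site_power_def norm_block
proof (intro continuous_intros)
  show "continuous_on S (\<lambda>W. if site D i = l then (cmod (W $ k $ i))\<^sup>2 else 0)" for i k
    by (cases "site D i = l") (auto intro!: continuous_intros)
qed

lemma continuous_on_f_obj: "continuous_on S (\<lambda>W. f_obj D W a)"
  unfolding f_obj_eq by (intro continuous_intros)

lemma continuous_on_G_con: "continuous_on S (\<lambda>W. G_con D W a)"
  unfolding G_con_def herm_B_sel site_power_def[symmetric]
  by (intro continuous_intros continuous_on_site_power)

lemma f_obj_convex:
  assumes "u \<ge> 0" "v \<ge> 0" "u + v = 1"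
  shows "f_obj D (u *\<^sub>R V + v *\<^sub>R W) a \<le> u * f_obj D V a + v * f_obj D W a"
proof -
  have "a \<bullet> impl_power D = u * (a \<bullet> impl_power D) + v * (a \<bullet> impl_power D)"
    using assms(3) by (simp flip: distrib_right)
  then show ?thesis
    using power2_norm_convex_le[OF assms, of V W] by (simp add: f_obj_eq distrib_left)
qed

lemma G_con_convex:
  assumes "u \<ge> 0" "v \<ge> 0" "u + v = 1"
  shows "G_con D (u *\<^sub>R V + v *\<^sub>R W) a \<le> u *\<^sub>R G_con D V a + v *\<^sub>R G_con D W a"
  unfolding less_eq_vec_def
proof
  fix l
  have "a $ l * power_limit D $ l = u * (a $ l * power_limit D $ l) + v * (a $ l * power_limit D $ l)"
    using assms(3) by (simp flip: distrib_right)
  then show "G_con D (u *\<^sub>R V + v *\<^sub>R W) a $ l \<le> (u *\<^sub>R G_con D V a + v *\<^sub>R G_con D W a) $ l"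
    using site_power_convex[OF assms, of D l V W] by (simp add: G_con_nth right_diff_distrib)
qed

lemma bounded_if_power2_norm_le:
  assumes "\<And>x. x \<in> S \<Longrightarrow> (norm x)\<^sup>2 \<le> c"
  shows "bounded S"
  unfolding bounded_iff by (intro exI[of _ "sqrt c"] ballI real_le_rsqrt assms)

text \<open>The site powers add up to the squared norm of \<open>W\<close>, so bounding each of them
  bounds \<open>W\<close>: the constraint map is coercive by itself.\<close>

lemma bounded_G_con_le: "bounded {W \<in> S. G_con D W a \<le> y}"
proof (rule bounded_if_power2_norm_le)
  fix W assume "W \<in> {W \<in> S. G_con D W a \<le> y}"
  then have "site_power D l W \<le> y $ l + a $ l * power_limit D $ l" for l
    by (metis (mono_tags, lifting) G_con_nth diff_le_eq less_eq_vec_def mem_Collect_eq)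
  then show "(norm W)\<^sup>2 \<le> (\<Sum>l\<in>UNIV. y $ l + a $ l * power_limit D $ l)"
    unfolding sum_site_power[symmetric, of W D] by (rule sum_mono)
qed

(* Its norm is the left-hand side of the SINR constraint, which is therefore convex in W. *)
definition interference ::
  "('n::finite, 'l::finite, 'k::finite) network \<Rightarrow> 'k \<Rightarrow> complex^'n^'k \<Rightarrow> complex^'k" where
  "interference D k W = (\<chi> i. if i = k then of_real (sqrt (noise D $ k)) else herm (chan D $ k) (W $ i))"

lemma norm_interference:
  assumes "valid_network D"
  shows "norm (interference D k W) =
    sqrt ((\<Sum>i\<in>UNIV - {k}. (cmod (herm (chan D $ k) (W $ i)))\<^sup>2) + noise D $ k)"
proof -
  have "0 < noise D $ k"
    using assms by (simp add: valid_network_def)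
  then have "(\<Sum>i\<in>UNIV. (cmod (interference D k W $ i))\<^sup>2)
    = noise D $ k + (\<Sum>i\<in>UNIV - {k}. (cmod (herm (chan D $ k) (W $ i)))\<^sup>2)"
    unfolding interference_def by (subst sum.remove[of _ k]) auto
  then have "(norm (interference D k W))\<^sup>2
    = (\<Sum>i\<in>UNIV - {k}. (cmod (herm (chan D $ k) (W $ i)))\<^sup>2) + noise D $ k"
    unfolding power2_norm_vec by (simp add: add.commute)
  then show ?thesis
    by (rule real_sqrt_unique[symmetric]) simp
qed

lemma beamformers_eq:
  assumes "valid_network D"
  shows "beamformers D = {W. \<forall>k.
     norm (interference D k W) \<le> 1 / sqrt (target D $ k) * Re (herm (chan D $ k) (W $ k)) \<and>
     Im (herm (chan D $ k) (W $ k)) = 0}"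
  by (simp add: beamformers_def norm_interference[OF assms])

text \<open>The noise entry is constant in \<open>W\<close>, so the map is affine rather than
  linear; hence the weights must sum to one.\<close>

lemma interference_convex_combination:
  assumes "u + v = 1"
  shows "interference D k (u *\<^sub>R V + v *\<^sub>R W) = u *\<^sub>R interference D k V + v *\<^sub>R interference D k W"
proof -
  have "complex_of_real (sqrt (noise D $ k)) =
      u *\<^sub>R complex_of_real (sqrt (noise D $ k)) + v *\<^sub>R complex_of_real (sqrt (noise D $ k))"
    using assms by (metis scaleR_add_left scaleR_one)
  then show ?thesis
    by (simp add: interference_def vec_eq_iff herm_add_right herm_scaleR_right)
qed

lemma closed_beamformers:
  assumes "valid_network D"
  shows "closed (beamformers D)"
proof -
  have "continuous_on UNIV (\<lambda>W. if i = k then complex_of_real (sqrt (noise D $ k)) else herm (chan D $ k) (W $ i))"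
    for i k by (cases "i = k") (simp_all add: continuous_on_herm continuous_on_component)
  then have lhs: "continuous_on UNIV (\<lambda>W. norm (interference D k W))" for k
    unfolding interference_def by (intro continuous_on_norm continuous_on_vec_lambda)
  have rhs: "continuous_on UNIV (\<lambda>W. 1 / sqrt (target D $ k) * Re (herm (chan D $ k) (W $ k)))" for k
    by (intro continuous_on_mult_left continuous_on_Re continuous_on_herm continuous_on_component continuous_on_id)
  have im: "continuous_on UNIV (\<lambda>W. Im (herm (chan D $ k) (W $ k)))" for k
    by (intro continuous_on_Im continuous_on_herm continuous_on_component continuous_on_id)
  show ?thesis
    unfolding beamformers_eq[OF assms]
    by (intro closed_Collect_all closed_Collect_conj closed_Collect_le[OF lhs rhs]
      closed_Collect_eq[OF im] continuous_on_const)
qed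

lemma convex_beamformers:
  fixes D :: "('n::finite, 'l::finite, 'k::finite) network"
  assumes "valid_network D"
  shows "convex (beamformers D)"
proof (rule convexI)
  fix V W :: "complex^'n^'k" and u v :: real
  assume V: "V \<in> beamformers D" and W: "W \<in> beamformers D" and uv: "0 \<le> u" "0 \<le> v" "u + v = 1"
  let ?r = "\<lambda>k W. 1 / sqrt (target D $ k) * Re (herm (chan D $ k) (W $ k))"
  have "norm (interference D k (u *\<^sub>R V + v *\<^sub>R W)) \<le> ?r k (u *\<^sub>R V + v *\<^sub>R W)" for k
  proof -
    have "norm (interference D k (u *\<^sub>R V + v *\<^sub>R W)) \<le>
        u * norm (interference D k V) + v * norm (interference D k W)"
      using norm_triangle_ineq[of "u *\<^sub>R interference D k V" "v *\<^sub>R interference D k W"] uv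
      by (simp add: interference_convex_combination)
    also have "\<dots> \<le> u * ?r k V + v * ?r k W"
      using V W uv unfolding beamformers_eq[OF assms] by (intro add_mono mult_left_mono) auto
    also have "\<dots> = ?r k (u *\<^sub>R V + v *\<^sub>R W)"
      by (simp add: herm_add_right herm_scaleR_right add_divide_distrib)
    finally show ?thesis .
  qed
  moreover have "Im (herm (chan D $ k) ((u *\<^sub>R V + v *\<^sub>R W) $ k)) = 0" for k
    using V W by (simp add: beamformers_def herm_add_right herm_scaleR_right)
  ultimately show "u *\<^sub>R V + v *\<^sub>R W \<in> beamformers D"
    unfolding beamformers_eq[OF assms] by blast
qed

section \<open>Phase rotation: passing between (P) and the subproblems\<close>

text \<open>Rotating each beamformer so that its own received signal becomes real and nonnegative
  preserves all moduli, hence interference, site powers and objective.\<close>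

lemma sub_feasible_if_P_feasible:
  fixes D :: "('n::finite, 'l::finite, 'k::finite) network"
  assumes D: "valid_network D" and Wa: "(W, a) \<in> P_feasible D"
  obtains V where "V \<in> sub_feasible D a" "f_obj D V a = P_objective D W a"
proof -
  define z where "z k = herm (chan D $ k) (W $ k)" for k
  \<comment> \<open>The default 1 at a vanishing signal gives the factor modulus one in every
    case.\<close>
  define c where "c k = (if z k = 0 then 1 else cnj (z k) / cmod (z k))" for k
  define V where "V = (\<chi> k i. c k * W $ k $ i)"
  have c: "cmod (c k) = 1" "c k * z k = cmod (z k)" for k
    by (auto simp: c_def norm_divide complex_norm_square[symmetric] power2_eq_square mult.commute[of "cnj _"])
  have herm_V: "herm u (V $ i) = c i * herm u (W $ i)" for u i
    using herm_smult_right[of u "c i" "W $ i"] by (simp add: V_def)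
  have power_V: "site_power D l V = site_power D l W" for l
    by (simp add: site_power_def norm_block V_def norm_mult c cong: if_cong)
  have "sqrt ((\<Sum>i\<in>UNIV - {k}. (cmod (herm (chan D $ k) (V $ i)))\<^sup>2) + noise D $ k)
       \<le> 1 / sqrt (target D $ k) * Re (herm (chan D $ k) (V $ k))" for k
  proof -
    let ?I = "(\<Sum>i\<in>UNIV - {k}. (cmod (herm (chan D $ k) (W $ i)))\<^sup>2) + noise D $ k"
    have pos: "?I > 0" "target D $ k > 0"
      using D by (auto simp: valid_network_def intro!: add_nonneg_pos sum_nonneg)
    have "target D $ k \<le> (cmod (z k))\<^sup>2 / ?I"
      using Wa by (simp add: P_feasible_def SINR_def sum_herm_block z_def)
    then have "?I \<le> (cmod (z k))\<^sup>2 / target D $ k"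
      using pos by (simp add: field_simps)
    then have "sqrt ?I \<le> sqrt ((cmod (z k))\<^sup>2 / target D $ k)"
      by (rule real_sqrt_le_mono)
    then show ?thesis
      by (simp add: herm_V norm_mult c real_sqrt_divide flip: z_def)
  qed
  then have "V \<in> beamformers D"
    by (simp add: beamformers_def herm_V c flip: z_def)
  moreover have "G_con D V a \<le> 0"
    using Wa by (simp add: less_eq_vec_def G_con_nth power_V P_feasible_def flip: site_power_def)
  ultimately have "V \<in> sub_feasible D a"
    by (simp add: sub_feasible_def)
  moreover have "f_obj D V a = P_objective D W a"
    by (simp add: P_objective_eq f_obj_eq power_V flip: sum_site_power[of D])
  ultimately show thesis
    by (rule that)
qed

text \<open>The same \<open>W\<close> serves: both sides of the cone constraint may be squared since
  the root is nonnegative, and the real part of the signal is at most its modulus in absolute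
  value.\<close>

lemma P_feasible_if_sub_feasible:
  fixes D :: "('n::finite, 'l::finite, 'k::finite) network"
  assumes D: "valid_network D" and W: "W \<in> sub_feasible D a" and a: "a \<in> activations"
  shows "(W, a) \<in> P_feasible D"
proof -
  have "target D $ k \<le> SINR D W k" for k
  proof -
    let ?z = "herm (chan D $ k) (W $ k)"
    let ?I = "(\<Sum>i\<in>UNIV - {k}. (cmod (herm (chan D $ k) (W $ i)))\<^sup>2) + noise D $ k"
    have pos: "?I > 0" "target D $ k > 0"
      using D by (auto simp: valid_network_def intro!: add_nonneg_pos sum_nonneg)
    have "sqrt ?I \<le> 1 / sqrt (target D $ k) * Re ?z"
      using W by (simp add: sub_feasible_def beamformers_def)
    then have "(sqrt ?I)\<^sup>2 \<le> (1 / sqrt (target D $ k) * Re ?z)\<^sup>2"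
      using pos by (intro power_mono) auto
    then have "?I \<le> (Re ?z)\<^sup>2 / target D $ k"
      using pos by (simp add: power_divide)
    also have "\<dots> \<le> (cmod ?z)\<^sup>2 / target D $ k"
      using pos by (intro divide_right_mono) (auto simp: cmod_power2)
    finally show ?thesis
      using pos by (simp add: SINR_def sum_herm_block field_simps)
  qed
  moreover have "G_con D W a \<le> 0"
    using W by (simp add: sub_feasible_def)
  ultimately show ?thesis
    using a by (simp add: P_feasible_def activations_def less_eq_vec_def G_con_nth site_power_def)
qed

section \<open>Weak duality and lower bounds of the dual functions\<close>

text \<open>Real infima act as lower bounds only over sets bounded below. Dropping the nonnegative
  site powers leaves a constant that does so.\<close>

lemma bdd_below_G_con:
  assumes "0 \<le> \<mu>"
  shows "bdd_below ((\<lambda>W. \<mu> \<bullet> G_con D W a) ` S)"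
proof (rule bdd_belowI2)
  fix W
  have "0 \<le> \<mu> \<bullet> (G_con D W a - (\<chi> l. - (a $ l * power_limit D $ l)))"
    by (intro inner_nonneg_nonneg assms) (simp add: less_eq_vec_def G_con_nth site_power_nonneg)
  then show "\<mu> \<bullet> (\<chi> l. - (a $ l * power_limit D $ l)) \<le> \<mu> \<bullet> G_con D W a"
    by (simp add: inner_diff_right)
qed

lemma bdd_below_f_obj: "bdd_below ((\<lambda>W. f_obj D W a) ` S)"
  by (rule bdd_belowI2[of _ "a \<bullet> impl_power D"]) (simp add: f_obj_eq)

lemma bdd_below_Lagrangian:
  assumes "0 \<le> \<mu>"
  shows "bdd_below ((\<lambda>W. f_obj D W a + \<mu> \<bullet> G_con D W a) ` S)"
proof -
  obtain m where "\<And>W. W \<in> S \<Longrightarrow> m \<le> \<mu> \<bullet> G_con D W a"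
    using bdd_below_G_con[OF assms] unfolding bdd_below_def by blast
  then show ?thesis
    by (intro bdd_belowI2[of _ "a \<bullet> impl_power D + m"]) (auto simp: f_obj_eq intro: add_increasing)
qed

text \<open>Weak duality: the penalty term is nonpositive at a feasible \<open>W\<close>. Optimality
  cuts therefore never cut off a feasible objective value.\<close>

lemma L_upper_le_f_obj:
  assumes "0 \<le> \<mu>" "W \<in> sub_feasible D a"
  shows "L_upper D a \<mu> \<le> f_obj D W a"
proof -
  have W: "W \<in> beamformers D" "G_con D W a \<le> 0"
    using assms(2) by (auto simp: sub_feasible_def)
  have "L_upper D a \<mu> \<le> f_obj D W a + \<mu> \<bullet> G_con D W a"
    unfolding L_upper_def by (intro cINF_lower bdd_below_Lagrangian assms W)
  moreover have "0 \<le> \<mu> \<bullet> (- G_con D W a)"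
    by (intro inner_nonneg_nonneg) (use assms W in auto)
  ultimately show ?thesis
    by simp
qed

text \<open>Feasibility cuts never remove an activation vector whose subproblem is feasible, since
  nonnegative weights keep nonpositive constraint values nonpositive.\<close>

lemma L_lower_le_0:
  assumes "lam \<in> \<Lambda>" "W \<in> sub_feasible D a"
  shows "L_lower D a lam \<le> 0"
proof -
  have W: "W \<in> beamformers D" "G_con D W a \<le> 0" and lam: "0 \<le> lam"
    using assms by (auto simp: sub_feasible_def \<Lambda>_def)
  have "L_lower D a lam \<le> lam \<bullet> G_con D W a"
    unfolding L_lower_def by (intro cINF_lower bdd_below_G_con lam W)
  moreover have "0 \<le> lam \<bullet> (- G_con D W a)"
    by (intro inner_nonneg_nonneg) (use lam W in auto)
  ultimately show ?thesis
    by simp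
qed

section \<open>Attainment, separating multipliers and strong duality\<close>

text \<open>The feasible set is compact by coercivity of the constraints, so the continuous
  objective attains its minimum.\<close>

lemma sub_solution_exists:
  assumes "valid_network D" "a \<in> \<V> D"
  obtains W where "sub_solution D a W"
proof -
  have "closed (sub_feasible D a)"
    unfolding sub_feasible_def Collect_conj_eq Collect_mem_eq less_eq_vec_def
    by (intro closed_Int closed_beamformers assms closed_Collect_all closed_Collect_le
      continuous_intros continuous_on_G_con)
  moreover have "bounded (sub_feasible D a)"
    unfolding sub_feasible_def by (rule bounded_G_con_le)
  ultimately have "compact (sub_feasible D a)"
    by (simp add: compact_eq_bounded_closed)
  then obtain W where W: "W \<in> sub_feasible D a" "\<And>V. V \<in> sub_feasible D a \<Longrightarrow> f_obj D W a \<le> f_obj D V a"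
    using continuous_attains_inf[OF _ _ continuous_on_f_obj, of "sub_feasible D a" D a] assms(2)
    by (auto simp: \<V>_def)
  then have "v_sub D a = f_obj D W a"
    unfolding v_sub_def by (intro cInf_eq_minimum) auto
  with W(1) show thesis
    by (intro that) (simp add: sub_solution_def)
qed

lemma separating_multiplier_exists:
  fixes D :: "('n::finite, 'l::finite, 'k::finite) network"
  assumes D: "valid_network D" and ne: "beamformers D \<noteq> {}" and a: "a \<notin> \<V> D"
  obtains lam where "lam \<in> \<Lambda>" "(INF W \<in> beamformers D. lam \<bullet> G_con D W a) > 0"
proof -
  have "\<not> (\<exists>W\<in>beamformers D. G_con D W a \<le> 0)"
    using a by (auto simp: \<V>_def sub_feasible_def)
  then obtain \<nu> b where \<nu>: "0 \<le> \<nu>" "\<nu> \<bullet> 0 < b" "\<And>W. W \<in> beamformers D \<Longrightarrow> b < \<nu> \<bullet> G_con D W a"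
    by (rule separate_upward_image[OF closed_beamformers[OF D] convex_beamformers[OF D] ne
          continuous_on_G_con G_con_convex bounded_G_con_le, rotated 3]) blast+
  define s where "s = (\<Sum>l\<in>UNIV. \<nu> $ l)"
  \<comment> \<open>A zero normal would give both \<open>0 < b\<close> and \<open>b < 0\<close>. The
    positive component sum then allows normalization into \<open>\<Lambda>\<close>.\<close>
  have "\<nu> \<noteq> 0"
    using \<nu>(2,3) ne by fastforce
  moreover have nonneg: "\<And>l. 0 \<le> \<nu> $ l"
    using \<nu>(1) by (simp add: less_eq_vec_def)
  ultimately have "s > 0"
    by (auto simp: s_def vec_eq_iff less_le sum_nonneg sum_nonneg_eq_0_iff)
  show thesis
  proof
    have "(\<Sum>l\<in>UNIV. (\<nu> /\<^sub>R s) $ l) = inverse s * s"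
      unfolding s_def by (simp add: sum_distrib_left)
    then show "\<nu> /\<^sub>R s \<in> \<Lambda>"
      using \<open>s > 0\<close> nonneg by (simp add: \<Lambda>_def less_eq_vec_def)
    \<comment> \<open>The uniform gap \<open>b / s\<close> keeps the infimum positive; pointwise
      positivity would only make it nonnegative.\<close>
    have "0 < b / s"
      using \<nu>(2) \<open>s > 0\<close> by simp
    also have "b / s \<le> (INF W \<in> beamformers D. (\<nu> /\<^sub>R s) \<bullet> G_con D W a)"
      using \<nu>(3) \<open>s > 0\<close> by (intro cINF_greatest ne) (auto simp: field_simps less_imp_le)
    finally show "(INF W \<in> beamformers D. (\<nu> /\<^sub>R s) \<bullet> G_con D W a) > 0" .
  qed
qed

text \<open>No beamformer has objective at most \<open>c\<close> and nonpositive constraints, so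
  \<open>(c, 0)\<close> can be separated from the joint image. Scaling the normal to objective
  weight one yields the multiplier. Working strictly below \<open>v_sub D a\<close> avoids any claim
  that the dual supremum is attained.\<close>

lemma multiplier_approx:
  fixes D :: "('n::finite, 'l::finite, 'k::finite) network"
  assumes D: "valid_network D" and a: "a \<in> \<V> D" and c: "c < v_sub D a"
  obtains \<mu> where "0 \<le> \<mu>" "c \<le> L_upper D a \<mu>"
proof -
  \<comment> \<open>Pairs are ordered componentwise, so the separation lemma treats objective and
    constraints at once.\<close>
  let ?q = "\<lambda>W. (f_obj D W a, G_con D W a)"
  obtain W0 where W0: "W0 \<in> beamformers D" "G_con D W0 a \<le> 0"
    using a by (auto simp: \<V>_def sub_feasible_def)
  have "v_sub D a \<le> f_obj D W a" if "W \<in> beamformers D" "G_con D W a \<le> 0" for W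
    unfolding v_sub_def using that by (intro cINF_lower bdd_below_f_obj) (simp add: sub_feasible_def)
  then have sep: "\<not> (\<exists>W\<in>beamformers D. ?q W \<le> (c, 0))"
    using c by fastforce
  have cont: "continuous_on (beamformers D) ?q"
    by (intro continuous_on_Pair continuous_on_f_obj continuous_on_G_con)
  have conv: "?q (u *\<^sub>R V + v *\<^sub>R W) \<le> u *\<^sub>R ?q V + v *\<^sub>R ?q W" if "u \<ge> 0" "v \<ge> 0" "u + v = 1" for V W u v
    using f_obj_convex[OF that, of D V W a] G_con_convex[OF that, of D V W a] by simp
  have bdd: "bounded {W \<in> beamformers D. ?q W \<le> y}" for y
    by (rule bounded_subset[OF bounded_G_con_le[of "beamformers D" D a "snd y"]]) (auto simp: less_eq_prod_def)
  obtain \<nu> b where \<nu>: "0 \<le> \<nu>" "\<nu> \<bullet> (c, 0) < b" "\<And>W. W \<in> beamformers D \<Longrightarrow> b < \<nu> \<bullet> ?q W"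
    by (rule separate_upward_image[OF closed_beamformers[OF D] convex_beamformers[OF D] _ cont conv bdd sep])
       (use W0(1) in blast)+
  obtain \<rho> m where \<nu>_eq: "\<nu> = (\<rho>, m)"
    by (cases \<nu>)
  have \<rho>: "0 \<le> \<rho>" and m: "0 \<le> m"
    using \<nu>(1) by (auto simp: \<nu>_eq zero_prod_def)
  have lt: "\<rho> * c < b" and gt: "\<And>W. W \<in> beamformers D \<Longrightarrow> b < \<rho> * f_obj D W a + m \<bullet> G_con D W a"
    using \<nu>(2,3) by (auto simp: \<nu>_eq)
  (* Feasibility of W0 alone rules out a vertical hyperplane; no Slater condition is needed. *)
  have "\<rho> \<noteq> 0"
    using lt gt[OF W0(1)] inner_nonneg_nonneg[OF m, of "- G_con D W0 a"] W0(2) by auto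
  with \<rho> have "\<rho> > 0"
    by simp
  show thesis
  proof
    show "0 \<le> m /\<^sub>R \<rho>"
      using m \<rho> by (simp add: less_eq_vec_def)
    have "c \<le> f_obj D W a + (m /\<^sub>R \<rho>) \<bullet> G_con D W a" if "W \<in> beamformers D" for W
    proof -
      have "\<rho> * c \<le> \<rho> * (f_obj D W a + (m /\<^sub>R \<rho>) \<bullet> G_con D W a)"
        using lt gt[OF that] \<open>\<rho> > 0\<close> by (simp add: distrib_left mult.assoc[symmetric])
      then show ?thesis
        using \<open>\<rho> > 0\<close> by simp
    qed
    then show "c \<le> L_upper D a (m /\<^sub>R \<rho>)"
      unfolding L_upper_def using W0 by (intro cINF_greatest) auto
  qed
qed

text \<open>A maximizer of the dual function dominates every approximating multiplier, which closes
  the duality gap. The new optimality cut thus reaches the subproblem value at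
  \<open>a\<close>.\<close>

lemma optimal_multiplier_ge:
  assumes "valid_network D" "a \<in> \<V> D" "optimal_multiplier D a \<mu>"
  shows "v_sub D a \<le> L_upper D a \<mu>"
proof (rule dense_le)
  fix c assume "c < v_sub D a"
  then show "c \<le> L_upper D a \<mu>"
    using multiplier_approx[OF assms(1,2)] assms(3) by (metis optimal_multiplier_def order_trans)
qed

section \<open>Termination rank and invariant of the algorithm\<close>

lemma finite_activations: "finite (activations :: (real^'l::finite) set)"
proof -
  have "activations \<subseteq> vec_lambda ` (UNIV \<rightarrow>\<^sub>E {0, 1 :: real} :: ('l \<Rightarrow> real) set)"
  proof
    fix a :: "real^'l" assume "a \<in> activations"
    then have "vec_nth a \<in> UNIV \<rightarrow>\<^sub>E {0, 1}" "a = vec_lambda (vec_nth a)"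
      by (auto simp: activations_def)
    then show "a \<in> vec_lambda ` (UNIV \<rightarrow>\<^sub>E {0, 1})"
      by blast
  qed
  then show ?thesis
    by (rule finite_subset) (intro finite_imageI finite_PiE finite finite.intros)
qed

text \<open>Chosen so that no master solution with value below \<open>UB\<close> can sit at an
  excluded vector: there the cuts force the value up to \<open>UB\<close> or are violated.\<close>

definition excluded ::
  "('n::finite, 'l::finite, 'k::finite) network \<Rightarrow> (real^'l) list \<Rightarrow> (real^'l) list \<Rightarrow> ereal \<Rightarrow> real^'l \<Rightarrow> bool" where
  "excluded D ms ls UB a \<longleftrightarrow>
     (\<exists>\<mu>\<in>set ms. UB \<le> ereal (L_upper D a \<mu>)) \<or> (\<exists>lam\<in>set ls. 0 < L_lower D a lam)"

abbreviation remaining ::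
  "('n::finite, 'l::finite, 'k::finite) network \<Rightarrow> (real^'l) list \<Rightarrow> (real^'l) list \<Rightarrow> ereal \<Rightarrow> (real^'l) set" where
  "remaining D ms ls UB \<equiv> {a \<in> activations. \<not> excluded D ms ls UB a}"

text \<open>Step 1 removes at least one remaining vector; the factor 2 turns this into a drop by at
  least 2, which pays for the larger offset of \<open>Master\<close>. Step 2 either lowers the
  offset by one or ends at 0.\<close>

primrec config_rank :: "('n::finite, 'l::finite, 'k::finite) network \<Rightarrow> ('n, 'l, 'k) config \<Rightarrow> nat" where
  "config_rank D (Solve a ms ls LB UB inc) = 2 * card (remaining D ms ls UB) + 1"
| "config_rank D (Master ms ls LB UB inc) = 2 * card (remaining D ms ls UB) + 2"
| "config_rank D (Output W a) = 0"

definition valid_cuts :: "(real^'l) list \<Rightarrow> (real^'l::finite) list \<Rightarrow> bool" where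
  "valid_cuts ms ls \<longleftrightarrow> (\<forall>\<mu>\<in>set ms. 0 \<le> \<mu>) \<and> set ls \<subseteq> \<Lambda>"

definition valid_incumbent ::
  "('n::finite, 'l::finite, 'k::finite) network \<Rightarrow> ereal \<Rightarrow> ((complex^'n^'k) \<times> (real^'l)) option \<Rightarrow> bool" where
  "valid_incumbent D UB inc \<longleftrightarrow> (case inc of None \<Rightarrow> UB = \<infinity>
     | Some (W, a) \<Rightarrow> W \<in> sub_feasible D a \<and> a \<in> activations \<and> UB = ereal (f_obj D W a))"

text \<open>In \<open>Solve\<close>, membership in \<open>remaining\<close> ensures that the next
  cut excludes a new vector. Nothing is recorded about \<open>LB\<close> in \<open>Master\<close>,
  because step 2 overwrites it with the master value.\<close>

primrec invariant ::
  "('n::finite, 'l::finite, 'k::finite) network \<Rightarrow> real \<Rightarrow> ('n, 'l, 'k) config \<Rightarrow> bool" where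
  "invariant D \<epsilon> (Solve a ms ls LB UB inc) \<longleftrightarrow> a \<in> remaining D ms ls UB \<and> LB \<le> ereal (P_value D) \<and>
     valid_cuts ms ls \<and> valid_incumbent D UB inc"
| "invariant D \<epsilon> (Master ms ls LB UB inc) \<longleftrightarrow> valid_cuts ms ls \<and> valid_incumbent D UB inc"
| "invariant D \<epsilon> (Output W a) \<longleftrightarrow> eps_optimal D \<epsilon> W a"

text \<open>Adding cuts or lowering \<open>UB\<close> keeps old exclusions, so a newly excluded
  \<open>a\<close> makes the inclusion strict.\<close>

lemma remaining_decreases:
  assumes "a \<in> remaining D ms ls UB" "excluded D ms' ls' UB' a"
    and "set ms \<subseteq> set ms'" "set ls \<subseteq> set ls'" "UB' \<le> UB"
  shows "card (remaining D ms' ls' UB') < card (remaining D ms ls UB)"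
proof (rule psubset_card_mono)
  show "finite (remaining D ms ls UB)"
    by (rule finite_subset[OF _ finite_activations]) blast
  have "excluded D ms' ls' UB' a'" if "excluded D ms ls UB a'" for a'
    using that assms(3-5) unfolding excluded_def by (meson order_trans subsetD)
  then show "remaining D ms' ls' UB' \<subset> remaining D ms ls UB"
    using assms(1,2) by blast
qed

section \<open>The master problem as a relaxation of (P)\<close>

text \<open>Weak duality, applied to the phase-rotated point, shows that all cuts are valid for
  (P).\<close>

lemma master_feasible_if_P_feasible:
  assumes "valid_network D" "(W, a) \<in> P_feasible D" "valid_cuts ms ls"
  shows "(a, ereal (P_objective D W a)) \<in> master_feasible D ms ls"
proof -
  obtain V where "V \<in> sub_feasible D a" "f_obj D V a = P_objective D W a"
    using sub_feasible_if_P_feasible[OF assms(1,2)] .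
  moreover have "a \<in> activations"
    using assms(2) by (simp add: P_feasible_def activations_def)
  ultimately show ?thesis
    using assms(3) L_upper_le_f_obj[of _ V D a] L_lower_le_0[of _ V D a]
    by (fastforce simp: master_feasible_def valid_cuts_def)
qed

lemma master_value_le:
  assumes D: "valid_network D" and ne: "P_feasible D \<noteq> {}" and cuts: "valid_cuts ms ls"
    and sol: "master_solution D ms ls a a\<^sub>0"
  shows "a\<^sub>0 \<le> ereal (P_value D)"
proof -
  have le: "a\<^sub>0 \<le> ereal (P_objective D W a)" if "(W, a) \<in> P_feasible D" for W a
    using master_feasible_if_P_feasible[OF D that cuts] sol by (auto simp: master_solution_def)
  show ?thesis
  proof (cases a\<^sub>0)
    case (real r)
    then show ?thesis
      using le ne unfolding P_value_def by (auto intro!: cINF_greatest)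
  next
    case PInf
    then show ?thesis
      using le ne by fastforce
  qed simp
qed

lemma master_solution_exists:
  fixes D :: "('n::finite, 'l::finite, 'k::finite) network"
  assumes D: "valid_network D" and ne: "P_feasible D \<noteq> {}" and cuts: "valid_cuts ms ls"
  obtains a a\<^sub>0 where "master_solution D ms ls a a\<^sub>0"
proof -
  \<comment> \<open>\<open>g a\<close> is the least admissible \<open>a\<^sub>0\<close> at
    \<open>a\<close>; over an empty list of cuts this supremum is -\<infinity>. Only a minimization
    over finitely many vectors remains.\<close>
  define g where "g a = (SUP \<mu>\<in>set ms. ereal (L_upper D a \<mu>))" for a
  define C where "C = {a \<in> activations. \<forall>lam\<in>set ls. L_lower D a lam \<le> 0}"
  have feasible: "(a, a\<^sub>0) \<in> master_feasible D ms ls \<longleftrightarrow> a \<in> C \<and> g a \<le> a\<^sub>0" for a a\<^sub>0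
    by (auto simp: master_feasible_def C_def g_def SUP_le_iff)
  have "finite C"
    by (rule finite_subset[OF _ finite_activations]) (auto simp: C_def)
  moreover have "C \<noteq> {}"
    using master_feasible_if_P_feasible[OF D _ cuts] ne feasible by fast
  ultimately obtain a where a: "is_arg_min g (\<lambda>a. a \<in> C) a"
    using ex_is_arg_min_if_finite by blast
  have "master_solution D ms ls a (g a)"
    using a feasible unfolding master_solution_def is_arg_min_linorder
    by (auto intro: order_trans)
  then show thesis
    by (rule that)
qed

lemma eps_optimalI:
  assumes "valid_network D" "W \<in> sub_feasible D a" "a \<in> activations"
    and "ereal (f_obj D W a) \<le> ereal (P_value D) + ereal \<epsilon>"
  shows "eps_optimal D \<epsilon> W a"
  using assms P_feasible_if_sub_feasible by (auto simp: eps_optimal_def P_objective_eq)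

section \<open>Invariance, descent and progress of single steps\<close>

lemma step_invariant:
  assumes D: "valid_network D" and ne: "P_feasible D \<noteq> {}" and "\<epsilon> \<ge> 0"
    and "step D \<epsilon> c c'" "invariant D \<epsilon> c"
  shows "invariant D \<epsilon> c'"
  using assms(4,5)
proof cases
  case (infeasible a lam ms ls LB UB inc)
  then show ?thesis
    using assms(5) by (auto simp: valid_cuts_def)
next
  case (feasible_stop a W LB ms ls UB inc)
  then show ?thesis
    using assms(5) by (auto intro!: eps_optimalI D simp: sub_solution_def intro: order_trans add_right_mono)
next
  case (feasible_better a W LB \<mu> UB ms ls inc)
  then show ?thesis
    using assms(5) by (auto simp: valid_cuts_def valid_incumbent_def sub_solution_def optimal_multiplier_def)
next
  case (feasible_no_better a LB \<mu> UB ms ls inc)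
  then show ?thesis
    using assms(5) by (auto simp: valid_cuts_def optimal_multiplier_def)
next
  case (master_stop ms ls a a\<^sub>0 UB LB W a')
  then have "a\<^sub>0 \<le> ereal (P_value D)"
    using assms(5) by (intro master_value_le[OF D ne]) auto
  then have "UB \<le> ereal (P_value D) + ereal \<epsilon>"
    using master_stop(4) by (meson add_right_mono order_trans)
  then show ?thesis
    using master_stop assms(5) by (auto intro!: eps_optimalI D simp: valid_incumbent_def)
next
  case (master_continue ms ls a a\<^sub>0 UB LB inc)
  \<comment> \<open>As \<epsilon> is nonnegative, failing the stopping test gives
    \<open>a\<^sub>0 < UB\<close>, so the vector returned by the master problem is not
    excluded.\<close>
  have "a\<^sub>0 \<le> a\<^sub>0 + ereal \<epsilon>"
    using \<open>\<epsilon> \<ge> 0\<close> by (simp add: ereal_le_add_self)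
  with master_continue(4) have "a\<^sub>0 < UB"
    by (meson not_le order_trans)
  then have "a \<in> remaining D ms ls UB"
    using master_continue(3)
    by (fastforce simp: master_solution_def master_feasible_def excluded_def)
  then show ?thesis
    using master_continue assms(5) master_value_le[OF D ne _ master_continue(3)] by simp
qed

text \<open>Step 1 excludes the vector it works on. A separating cut is violated there; an
  optimality cut is at least \<open>v_sub D a\<close> there, which is the new \<open>UB\<close> or
  at least the old one.\<close>

lemma step_rank:
  assumes D: "valid_network D" and "step D \<epsilon> c c'" "invariant D \<epsilon> c"
  shows "config_rank D c' < config_rank D c"
  using assms(2,3)
proof cases
  case (infeasible a lam ms ls LB UB inc)
  then have "card (remaining D ms (ls @ [lam]) UB) < card (remaining D ms ls UB)"
    using assms(3) by (intro remaining_decreases[of a]) (auto simp: excluded_def L_lower_def)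
  then show ?thesis
    using infeasible by simp
next
  case (feasible_better a W LB \<mu> UB ms ls inc)
  then have "card (remaining D (ms @ [\<mu>]) ls (ereal (v_sub D a))) < card (remaining D ms ls UB)"
    using assms(3) optimal_multiplier_ge[OF D]
    by (intro remaining_decreases[of a]) (auto simp: excluded_def)
  then show ?thesis
    using feasible_better by simp
next
  case (feasible_no_better a LB \<mu> UB ms ls inc)
  then have "UB \<le> ereal (L_upper D a \<mu>)"
    using optimal_multiplier_ge[OF D] by (meson ereal_less_eq(3) not_less order_trans)
  then have "card (remaining D (ms @ [\<mu>]) ls UB) < card (remaining D ms ls UB)"
    using assms(3) feasible_no_better by (intro remaining_decreases[of a]) (auto simp: excluded_def)
  then show ?thesis
    using feasible_no_better by simp
qed simp_all

lemma step_exists: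
  fixes D :: "('n::finite, 'l::finite, 'k::finite) network"
  assumes D: "valid_network D" and ne: "P_feasible D \<noteq> {}"
    and inv: "invariant D \<epsilon> c" and "\<And>W a. c \<noteq> Output W a" and mult: "multiplier_available D \<epsilon> c"
  shows "\<exists>c'. step D \<epsilon> c c'"
proof (cases c)
  case c: (Solve a ms ls LB UB inc)
  show ?thesis
  proof (cases "a \<in> \<V> D")
    case True
    then obtain W where W: "sub_solution D a W"
      using sub_solution_exists[OF D] by blast
    show ?thesis
    proof (cases "ereal (v_sub D a) \<le> LB + ereal \<epsilon>")
      case True
      then show ?thesis
        using c W \<open>a \<in> \<V> D\<close> by (blast intro: feasible_stop)
    next
      case False
      then obtain \<mu> where "optimal_multiplier D a \<mu>"
        using mult c \<open>a \<in> \<V> D\<close> by (auto simp: multiplier_available_def)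
      then show ?thesis
        using c W False \<open>a \<in> \<V> D\<close> by (cases "ereal (v_sub D a) < UB") (blast intro: step.intros)+
    qed
  next
    case False
    obtain W a' where "(W, a') \<in> P_feasible D"
      using ne by fast
    \<comment> \<open>Separation needs a nonempty set; a rotated feasible point of (P) supplies an
      element.\<close>
    then have "beamformers D \<noteq> {}"
      using sub_feasible_if_P_feasible[OF D] by (metis (no_types, lifting) empty_iff mem_Collect_eq sub_feasible_def)
    then show ?thesis
      using separating_multiplier_exists[OF D _ False] c False infeasible by metis
  qed
next
  case c: (Master ms ls LB UB inc)
  with inv have cuts: "valid_cuts ms ls" and inc: "valid_incumbent D UB inc"
    by auto
  obtain a a\<^sub>0 where sol: "master_solution D ms ls a a\<^sub>0"
    using master_solution_exists[OF D ne cuts] .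
  \<comment> \<open>\<open>master_stop\<close> demands an incumbent. Without one \<open>UB\<close>
    is \<infinity>, and the stopping test fails because \<open>a\<^sub>0\<close> is bounded by the
    finite value of (P).\<close>
  have "a\<^sub>0 \<noteq> \<infinity>"
    using master_value_le[OF D ne cuts sol] by auto
  then have "inc \<noteq> None" if "UB \<le> a\<^sub>0 + ereal \<epsilon>"
    using that inc \<open>a\<^sub>0 \<noteq> \<infinity>\<close>
    by (cases a\<^sub>0) (auto simp: valid_incumbent_def split: option.splits)
  then show ?thesis
    using sol c by (cases "UB \<le> a\<^sub>0 + ereal \<epsilon>") (fastforce intro: step.intros)+
qed (use assms in auto)

text \<open>Since the open choices are nondeterministic, finite success is split into termination of
  every run, correctness of every output, and absence of deadlock. Only the last is conditional on
  an attained dual maximum, since step 1(b)(ii) asks for a maximizer.\<close>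

theorem proposition1:
  fixes D :: "('n::finite, 'l::finite, 'k::finite) network"
    and \<epsilon> :: real and a_init :: "real^'l"
  assumes "valid_network D"
    and "P_feasible D \<noteq> {}"
    and "\<epsilon> \<ge> 0"
    and "a_init \<in> activations"
  shows "(\<nexists>C. C 0 = initial a_init \<and> (\<forall>n::nat. step D \<epsilon> (C n) (C (Suc n)))) \<and>
    (\<forall>W a. reachable D \<epsilon> a_init (Output W a) \<longrightarrow> eps_optimal D \<epsilon> W a) \<and>
    (\<forall>c. reachable D \<epsilon> a_init c \<and> (\<forall>W a. c \<noteq> Output W a) \<and> multiplier_available D \<epsilon> c
       \<longrightarrow> (\<exists>c'. step D \<epsilon> c c'))"
proof (intro conjI allI impI)
  have init: "invariant D \<epsilon> (initial a_init)"
    using assms(4)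
    by (simp add: initial_def excluded_def valid_cuts_def valid_incumbent_def)
  have inv: "invariant D \<epsilon> c" if "reachable D \<epsilon> a_init c" for c
    using that init by (induction rule: rtranclp_induct) (auto intro: step_invariant[OF assms(1-3)])
  show "\<nexists>C. C 0 = initial a_init \<and> (\<forall>n::nat. step D \<epsilon> (C n) (C (Suc n)))"
  proof
    assume "\<exists>C. C 0 = initial a_init \<and> (\<forall>n::nat. step D \<epsilon> (C n) (C (Suc n)))"
    then obtain C where C: "C 0 = initial a_init" "\<And>n. step D \<epsilon> (C n) (C (Suc n))"
      by blast
    have "reachable D \<epsilon> a_init (C n)" for n
      by (induction n) (auto simp: C(1) intro: rtranclp.rtrancl_into_rtrancl C(2))
    then have "config_rank D (C (Suc n)) < config_rank D (C n)" for n
      using step_rank[OF assms(1) C(2)] inv by blast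
    then show False
      using wf_measure[of "config_rank D"] unfolding wf_iff_no_infinite_down_chain by auto
  qed
  show "eps_optimal D \<epsilon> W a" if "reachable D \<epsilon> a_init (Output W a)" for W a
    using inv[OF that] by simp
  show "\<exists>c'. step D \<epsilon> c c'"
    if "reachable D \<epsilon> a_init c \<and> (\<forall>W a. c \<noteq> Output W a) \<and> multiplier_available D \<epsilon> c" for c
    using step_exists[OF assms(1,2) inv] that by blast
qed

end
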